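(* Let $(X,S)$ be a $\frac12$-homogeneous coherent configuration. Let $L(S)=\mathbb C^S$ with its standard inner product and standard basis $S$, equipped with the bilinear multiplication $L(\dot\nabla)$ determined on basis elements by $a\cdot b=\sum_{c\in S}\dot\nabla_{ab}^c\,c$, and with unit element $L(e)=\sum_{p\in S,\,p\subseteq\mathrm{id}_X}p$, where $\dot\nabla_{ab}^c=\sqrt{\frac{\|c\|}{\|a\|\|b\|}}\,\nabla_{ab}^c$. Then the algebra $(L(S),L(\dot\nabla),L(e))$ in the category of finite dimensional Hilbert spaces is an $H^*$-algebra.
   Context: A coherent configuration $(X,S)$ is a finite set $X$ with a partition $S$ of $X\times X$ such that: if $p\in S$ contains some $(x,x)$ then $p\subseteq\mathrm{id}_X$; for $a,b,c\in S$ the number $\nabla_{ab}^c$ of $z\in X$ with $(x,z)\in a$, $(z,y)\in b$ is the same for all $(x,y)\in c$; and $c\in S$ implies $c^{-1}=\{(y,x):(x,y)\in c\}\in S$. The valency $\|a\|$ of $a\in S$ is the number of $y\in X$ with $(x,y)\in a$, for any $x$ for which at least one such $y$ exists (independent of $x$). $(X,S)$ is $\frac12$-homogeneous if all $p\in S$ with $p\subseteq \mathrm{id}_X$ have the same cardinality. $L$ is the functor sending a finite set $Y$ to $\mathbb C^Y$ and a non-negative real matrix to the corresponding linear map in the standard bases. An $H^*$-algebra is an algebra $A$ over $\mathbb C$ equipped with an anti-linear involution $\dagger\colon A\to A$ that is also a Hilbert space satisfying $\langle ab|c\rangle=\langle b|a^\dagger c\rangle=\langle a|cb^\dagger\rangle$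 for all $a,b,c\in A$. (Being an $H^*$-algebra here means that such an involution exists for the given algebra and inner product.) *)

theory Defs
  imports "HOL-Analysis.Analysis" "HOL-Library.Disjoint_Sets" "HOL-Library.Function_Algebras"
begin

section \<open>Coherent configurations\<close>

locale coherent_configuration =
  fixes X :: "'a set" and S :: "'a rel set"
  assumes finite_points: "finite X"
    and partition: "partition_on (X \<times> X) S"
    and diagonal: "\<And>p x. p \<in> S \<Longrightarrow> (x, x) \<in> p \<Longrightarrow> p \<subseteq> Id_on X"
    and regular: "\<And>a b c. a \<in> S \<Longrightarrow> b \<in> S \<Longrightarrow> c \<in> S \<Longrightarrow>
      \<exists>n. \<forall>(x, y) \<in> c. card {z \<in> X. (x, z) \<in> a \<and> (z, y) \<in> b} = n"
    and converse_closed: "\<And>c. c \<in> S \<Longrightarrow> c\<inverse> \<in> S"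

definition half_homogeneous :: "'a set \<Rightarrow> 'a rel set \<Rightarrow> bool" where
  "half_homogeneous X S \<longleftrightarrow>
    (\<forall>p \<in> S. \<forall>q \<in> S. p \<subseteq> Id_on X \<longrightarrow> q \<subseteq> Id_on X \<longrightarrow> card p = card q)"

text \<open>In a coherent configuration the number described here exists and is unique, because the
  relations in a partition are nonempty. The same goes for \<open>valency\<close>.\<close>
definition intersection_number :: "'a set \<Rightarrow> 'a rel \<Rightarrow> 'a rel \<Rightarrow> 'a rel \<Rightarrow> nat" where
  "intersection_number X a b c =
    (THE n. \<forall>(x, y) \<in> c. card {z \<in> X. (x, z) \<in> a \<and> (z, y) \<in> b} = n)"

text \<open>\<open>Domain a\<close> is the set of points that have at least one \<open>a\<close>-neighbour.\<close>
definition valency :: "'a rel \<Rightarrow> nat" where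
  "valency a = (THE n. \<forall>x \<in> Domain a. card (a `` {x}) = n)"

definition normalized_number :: "'a set \<Rightarrow> 'a rel \<Rightarrow> 'a rel \<Rightarrow> 'a rel \<Rightarrow> real" where
  "normalized_number X a b c =
    sqrt (real (valency c) / (real (valency a) * real (valency b)))
      * real (intersection_number X a b c)"

section \<open>\<open>H\<^sup>*\<close>-algebras\<close>

text \<open>Spaces are given by a carrier \<open>A\<close> that is a linear subspace of an ambient complex vector
  space; the operations matter only on \<open>A\<close>. Algebras are associative and unital.\<close>

locale complex_algebra = vector_space scl
  for scl :: "complex \<Rightarrow> 'v::ab_group_add \<Rightarrow> 'v" +
  fixes A :: "'v set"
    and mul :: "'v \<Rightarrow> 'v \<Rightarrow> 'v"
    and unit :: 'v
  assumes subspace: "subspace A"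
    and mult_closed: "\<And>a b. a \<in> A \<Longrightarrow> b \<in> A \<Longrightarrow> mul a b \<in> A"
    and mult_add_left: "\<And>a b c. a \<in> A \<Longrightarrow> b \<in> A \<Longrightarrow> c \<in> A \<Longrightarrow>
      mul (a + b) c = mul a c + mul b c"
    and mult_add_right: "\<And>a b c. a \<in> A \<Longrightarrow> b \<in> A \<Longrightarrow> c \<in> A \<Longrightarrow>
      mul a (b + c) = mul a b + mul a c"
    and mult_scale_left: "\<And>k a b. a \<in> A \<Longrightarrow> b \<in> A \<Longrightarrow> mul (scl k a) b = scl k (mul a b)"
    and mult_scale_right: "\<And>k a b. a \<in> A \<Longrightarrow> b \<in> A \<Longrightarrow> mul a (scl k b) = scl k (mul a b)"
    and mult_assoc: "\<And>a b c. a \<in> A \<Longrightarrow> b \<in> A \<Longrightarrow> c \<in> A \<Longrightarrow>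
      mul (mul a b) c = mul a (mul b c)"
    and unit_closed: "unit \<in> A"
    and unit_left: "\<And>a. a \<in> A \<Longrightarrow> mul unit a = a"
    and unit_right: "\<And>a. a \<in> A \<Longrightarrow> mul a unit = a"

text \<open>Inner products are linear in the second argument.\<close>

locale complex_hilbert_space = vector_space scl
  for scl :: "complex \<Rightarrow> 'v::ab_group_add \<Rightarrow> 'v" +
  fixes A :: "'v set"
    and ip :: "'v \<Rightarrow> 'v \<Rightarrow> complex"
  assumes subspace: "subspace A"
    and ip_commute: "\<And>a b. a \<in> A \<Longrightarrow> b \<in> A \<Longrightarrow> ip a b = cnj (ip b a)"
    and ip_add_right: "\<And>a b c. a \<in> A \<Longrightarrow> b \<in> A \<Longrightarrow> c \<in> A \<Longrightarrow> ip a (b + c) = ip a b + ip a c"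
    and ip_scale_right: "\<And>k a b. a \<in> A \<Longrightarrow> b \<in> A \<Longrightarrow> ip a (scl k b) = k * ip a b"
    and ip_pos: "\<And>a. a \<in> A \<Longrightarrow> a \<noteq> 0 \<Longrightarrow> 0 < Re (ip a a)"
    and complete: "Metric_space.mcomplete A (\<lambda>a b. sqrt (Re (ip (a - b) (a - b))))"

definition finite_dimensional :: "(complex \<Rightarrow> 'v::ab_group_add \<Rightarrow> 'v) \<Rightarrow> 'v set \<Rightarrow> bool" where
  "finite_dimensional scl A \<longleftrightarrow> (\<exists>B. finite B \<and> module.span scl B = A)"

text \<open>Anti-multiplicativity of the involution is not assumed because it follows; see
  \<open>hstar_involution_antimultiplicative\<close> below.\<close>
definition hstar_involution ::
  "(complex \<Rightarrow> 'v::ab_group_add \<Rightarrow> 'v) \<Rightarrow> 'v set \<Rightarrow> ('v \<Rightarrow> 'v \<Rightarrow> 'v) \<Rightarrow> ('v \<Rightarrow> 'v \<Rightarrow> complex)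
    \<Rightarrow> ('v \<Rightarrow> 'v) \<Rightarrow> bool" where
  "hstar_involution scl A mul ip dag \<longleftrightarrow>
    (\<forall>a \<in> A. dag a \<in> A) \<and>
    (\<forall>a \<in> A. \<forall>b \<in> A. dag (a + b) = dag a + dag b) \<and>
    (\<forall>k. \<forall>a \<in> A. dag (scl k a) = scl (cnj k) (dag a)) \<and>
    (\<forall>a \<in> A. dag (dag a) = a) \<and>
    (\<forall>a \<in> A. \<forall>b \<in> A. \<forall>c \<in> A.
      ip (mul a b) c = ip b (mul (dag a) c) \<and> ip (mul a b) c = ip a (mul c (dag b)))"

definition hstar_algebra ::
  "(complex \<Rightarrow> 'v::ab_group_add \<Rightarrow> 'v) \<Rightarrow> 'v set \<Rightarrow> ('v \<Rightarrow> 'v \<Rightarrow> 'v) \<Rightarrow> 'v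
    \<Rightarrow> ('v \<Rightarrow> 'v \<Rightarrow> complex) \<Rightarrow> bool" where
  "hstar_algebra scl A mul unit ip \<longleftrightarrow>
    complex_algebra scl A mul unit \<and>
    complex_hilbert_space scl A ip \<and>
    (\<exists>dag. hstar_involution scl A mul ip dag)"

lemma hstar_involution_antimultiplicative:
  assumes alg: "complex_algebra scl A mul unit"
    and hil: "complex_hilbert_space scl A ip"
    and dag: "hstar_involution scl A mul ip dag"
    and a: "a \<in> A" and b: "b \<in> A"
  shows "dag (mul a b) = mul (dag b) (dag a)"
proof -
  interpret complex_algebra scl A mul unit by fact
  interpret H: complex_hilbert_space scl A ip by fact
  have dA: "dag x \<in> A" if "x \<in> A" for x
    using dag that by (simp add: hstar_involution_def)
  have adj: "ip (mul x y) z = ip y (mul (dag x) z)" if "x \<in> A" "y \<in> A" "z \<in> A" for x y z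
    using dag that by (simp add: hstar_involution_def)
  define u v where "u = dag (mul a b)" and "v = mul (dag b) (dag a)"
  have u: "u \<in> A"
    unfolding u_def by (intro dA mult_closed a b)
  have v: "v \<in> A"
    unfolding v_def by (intro dA mult_closed a b)
  have uv: "u - v \<in> A"
    using subspace u v by (rule subspace_diff)
  have eq: "ip x u = ip x v" if x: "x \<in> A" for x
  proof -
    have "ip x u = ip (mul (mul a b) x) unit"
      using a b x dA by (simp add: u_def adj mult_closed unit_closed unit_right)
    also have "\<dots> = ip x v"
      using a b x dA by (simp add: v_def mult_assoc adj mult_closed unit_closed unit_right)
    finally show ?thesis .
  qed
  have "ip (u - v) u = ip (u - v) (v + (u - v))" by simp
  also have "\<dots> = ip (u - v) v + ip (u - v) (u - v)"
    using uv v uv by (rule H.ip_add_right)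
  finally have "ip (u - v) (u - v) = 0" using eq[OF uv] by simp
  then have "u - v = 0" using H.ip_pos[OF uv] by (metis less_irrefl zero_complex.sel(1))
  then show ?thesis by (simp add: u_def v_def)
qed

section \<open>The algebra of a coherent configuration\<close>

text \<open>\<open>\<complex>\<^sup>S\<close> is the set of functions on the type of all relations that vanish outside \<open>S\<close>; addition
  on this type is pointwise.\<close>

definition fun_scale :: "complex \<Rightarrow> ('s \<Rightarrow> complex) \<Rightarrow> 's \<Rightarrow> complex" where
  "fun_scale k f = (\<lambda>s. k * f s)"

definition L_space :: "'s set \<Rightarrow> ('s \<Rightarrow> complex) set" where
  "L_space S = {f. \<forall>s. s \<notin> S \<longrightarrow> f s = 0}"

definition L_inner :: "'s set \<Rightarrow> ('s \<Rightarrow> complex) \<Rightarrow> ('s \<Rightarrow> complex) \<Rightarrow> complex" where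
  "L_inner S f g = (\<Sum>s\<in>S. cnj (f s) * g s)"

definition ket :: "'s \<Rightarrow> 's \<Rightarrow> complex" where
  "ket s = (\<lambda>t. if t = s then 1 else 0)"

definition L_mult :: "'a set \<Rightarrow> 'a rel set \<Rightarrow>
    ('a rel \<Rightarrow> complex) \<Rightarrow> ('a rel \<Rightarrow> complex) \<Rightarrow> 'a rel \<Rightarrow> complex" where
  "L_mult X S f g = (\<Sum>a\<in>S. \<Sum>b\<in>S. fun_scale (f a * g b)
    (\<Sum>c\<in>S. fun_scale (complex_of_real (normalized_number X a b c)) (ket c)))"

definition L_unit :: "'a set \<Rightarrow> 'a rel set \<Rightarrow> 'a rel \<Rightarrow> complex" where
  "L_unit X S = (\<Sum>p \<in> {p \<in> S. p \<subseteq> Id_on X}. ket p)"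

lemma L_mult_ket:
  assumes "finite S" "a \<in> S" "b \<in> S"
  shows "L_mult X S (ket a) (ket b) =
    (\<Sum>c\<in>S. fun_scale (complex_of_real (normalized_number X a b c)) (ket c))"
proof -
  define F where "F a b = (\<Sum>c\<in>S. fun_scale (complex_of_real (normalized_number X a b c)) (ket c))"
    for a b
  have term_eq: "fun_scale (ket a a' * ket b b') (F a' b') =
      (if b' = b then if a' = a then F a' b' else 0 else 0)" for a' b'
    by (auto simp: ket_def fun_scale_def fun_eq_iff)
  have "L_mult X S (ket a) (ket b) =
      (\<Sum>a'\<in>S. \<Sum>b'\<in>S. if b' = b then if a' = a then F a' b' else 0 else 0)"
    by (simp only: L_mult_def F_def[symmetric] term_eq)
  then show ?thesis using assms by (simp only: sum.delta F_def if_True)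
qed

end

theory Submission
  imports Defs
begin

text \<open>
  Half-homogeneity makes the size of every relation \<open>s\<close> a fixed multiple \<open>m \<cdot> \<parallel>s\<parallel>\<close> of its valency,
  where \<open>m\<close> is the common size of the diagonal relations. Hence sending the basis vector \<open>s\<close> to
  its \<open>0/1\<close> matrix divided by \<open>\<surd>\<parallel>s\<parallel>\<close> embeds \<open>\<complex>\<^sup>S\<close> as a unital algebra into the complex
  \<open>X \<times> X\<close> matrices and multiplies the inner product by \<open>m\<close> (the Frobenius inner product on
  matrices). The involution is the conjugate transpose.
\<close>

section \<open>The Hilbert space \<open>\<complex>\<^sup>S\<close>\<close>

lemma sum_fun_apply: "(\<Sum>i\<in>I. F i) x = (\<Sum>i\<in>I. F i x)"
  by (induction I rule: infinite_finite_induct) auto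

lemma vector_space_fun_scale: "vector_space (fun_scale :: complex \<Rightarrow> ('s \<Rightarrow> complex) \<Rightarrow> _)"
  by unfold_locales (auto simp: fun_scale_def fun_eq_iff algebra_simps)

lemma L_space_outside: "f \<in> L_space S \<Longrightarrow> s \<notin> S \<Longrightarrow> f s = 0"
  by (simp add: L_space_def)

lemma L_space_eqI:
  assumes "f \<in> L_space S" "g \<in> L_space S" "\<And>s. s \<in> S \<Longrightarrow> f s = g s"
  shows "f = g"
  using assms by (metis L_space_outside ext)

lemma subspace_L_space: "module.subspace fun_scale (L_space S)"
proof -
  interpret vector_space "fun_scale :: complex \<Rightarrow> ('a \<Rightarrow> complex) \<Rightarrow> _"
    by (rule vector_space_fun_scale)
  show ?thesis
    by (auto simp: subspace_def L_space_def fun_scale_def)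
qed

lemma sum_scale_ket_apply:
  assumes "finite S"
  shows "(\<Sum>s\<in>S. fun_scale (k s) (ket s)) t = (if t \<in> S then k t else 0)"
proof -
  have "(\<Sum>s\<in>S. fun_scale (k s) (ket s)) t = (\<Sum>s\<in>S. if t = s then k s else 0)"
    by (auto simp: sum_fun_apply fun_scale_def ket_def intro!: sum.cong)
  then show ?thesis using assms by simp
qed

lemma finite_dimensional_L_space:
  assumes "finite S"
  shows "finite_dimensional fun_scale (L_space S)"
proof -
  interpret vector_space "fun_scale :: complex \<Rightarrow> ('a \<Rightarrow> complex) \<Rightarrow> _"
    by (rule vector_space_fun_scale)
  have "span (ket ` S) = L_space S"
  proof (rule span_unique)
    show "ket ` S \<subseteq> L_space S"
      by (auto simp: ket_def L_space_def)
    show "subspace (L_space S)" by (rule subspace_L_space)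
    fix T assume T: "ket ` S \<subseteq> T" "subspace T"
    show "L_space S \<subseteq> T"
    proof
      fix f assume f: "f \<in> L_space S"
      have "f = (\<Sum>s\<in>S. fun_scale (f s) (ket s))"
        using f assms by (auto simp: fun_eq_iff sum_scale_ket_apply L_space_outside)
      also have "\<dots> \<in> T"
        using T by (intro subspace_sum subspace_scale) auto
      finally show "f \<in> T" .
    qed
  qed
  then show ?thesis
    using assms unfolding finite_dimensional_def by blast
qed

section \<open>Metric and completeness of \<open>L_space S\<close>\<close>

lemma L_inner_self: "Re (L_inner S f f) = (\<Sum>s\<in>S. (cmod (f s))\<^sup>2)"
  by (simp add: L_inner_def cmod_power2 flip: power2_eq_square)

text \<open>In the \<open>L2_set\<close> form, Minkowski's inequality and the bound of each
  coordinate by the norm can be used directly.\<close>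

lemma L_dist_eq: "sqrt (Re (L_inner S (f - g) (f - g))) = L2_set (\<lambda>s. cmod (f s - g s)) S"
  by (simp add: L_inner_self L2_set_def)

lemma Metric_space_L_space:
  assumes "finite S"
  shows "Metric_space (L_space S) (\<lambda>f g. L2_set (\<lambda>s. cmod (f s - g s)) S)"
proof
  fix f g h :: "'a \<Rightarrow> complex"
  show "0 \<le> L2_set (\<lambda>s. cmod (f s - g s)) S" by simp
  show "L2_set (\<lambda>s. cmod (f s - g s)) S = L2_set (\<lambda>s. cmod (g s - f s)) S"
    by (simp add: norm_minus_commute)
  show "L2_set (\<lambda>s. cmod (f s - g s)) S = 0 \<longleftrightarrow> f = g" if "f \<in> L_space S" "g \<in> L_space S"
    using assms that by (auto simp: L2_set_eq_0_iff intro: L_space_eqI)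
  have "L2_set (\<lambda>s. cmod (f s - h s)) S \<le> L2_set (\<lambda>s. cmod (f s - g s) + cmod (g s - h s)) S"
    by (intro L2_set_mono) (auto intro: norm_triangle_le_diff order_trans[OF _ norm_triangle_ineq])
  also have "\<dots> \<le> L2_set (\<lambda>s. cmod (f s - g s)) S + L2_set (\<lambda>s. cmod (g s - h s)) S"
    by (rule L2_set_triangle_ineq)
  finally show "L2_set (\<lambda>s. cmod (f s - h s)) S
      \<le> L2_set (\<lambda>s. cmod (f s - g s)) S + L2_set (\<lambda>s. cmod (g s - h s)) S" .
qed

text \<open>Every coordinate difference is at most the distance, so a Cauchy sequence is Cauchy in
  each coordinate and converges there. As the distance is a continuous expression in the finitely
  many coordinates, coordinatewise limits give a limit in the metric.\<close>

lemma mcomplete_L_space: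
  assumes "finite S"
  shows "Metric_space.mcomplete (L_space S) (\<lambda>f g. L2_set (\<lambda>s. cmod (f s - g s)) S)"
proof -
  interpret Metric_space "L_space S" "\<lambda>f g. L2_set (\<lambda>s. cmod (f s - g s)) S"
    by (rule Metric_space_L_space[OF assms])
  show ?thesis
    unfolding mcomplete_def
  proof (intro allI impI)
    fix \<sigma> assume \<sigma>: "MCauchy \<sigma>"
    have "convergent (\<lambda>n. \<sigma> n s)" if s: "s \<in> S" for s
    proof -
      have "Cauchy (\<lambda>n. \<sigma> n s)"
        unfolding Cauchy_def dist_norm
        using \<sigma> member_le_L2_set[OF assms s, of "\<lambda>s. cmod (\<sigma> _ s - \<sigma> _ s)"]
        unfolding MCauchy_def by (meson le_less_trans)
      then show ?thesis by (simp add: Cauchy_convergent_iff)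
    qed
    then obtain l where l: "\<And>s. s \<in> S \<Longrightarrow> (\<lambda>n. \<sigma> n s) \<longlonglongrightarrow> l s"
      unfolding convergent_def by metis
    \<comment> \<open>The value 0 outside \<open>S\<close> puts the limit into
      \<open>L_space S\<close>.\<close>
    define f where "f = (\<lambda>s. if s \<in> S then l s else 0)"
    have "(\<lambda>n. L2_set (\<lambda>s. cmod (\<sigma> n s - f s)) S) \<longlonglongrightarrow> L2_set (\<lambda>s. cmod (l s - f s)) S"
      unfolding L2_set_def by (intro tendsto_intros l)
    also have "L2_set (\<lambda>s. cmod (l s - f s)) S = 0"
      using assms by (simp add: L2_set_eq_0_iff f_def)
    finally have "(\<lambda>n. L2_set (\<lambda>s. cmod (\<sigma> n s - f s)) S) \<longlonglongrightarrow> 0" .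
    moreover have "f \<in> L_space S"
      by (simp add: f_def L_space_def)
    moreover have "\<sigma> n \<in> L_space S" for n
      using \<sigma> by (auto simp: MCauchy_def)
    ultimately have "limitin mtopology \<sigma> f sequentially"
      by (simp add: limit_metric_sequentially LIMSEQ_def)
    then show "\<exists>f. limitin mtopology \<sigma> f sequentially" by blast
  qed
qed

lemma complex_hilbert_space_L_space:
  assumes "finite S"
  shows "complex_hilbert_space fun_scale (L_space S) (L_inner S)"
proof -
  interpret vector_space "fun_scale :: complex \<Rightarrow> ('a \<Rightarrow> complex) \<Rightarrow> _"
    by (rule vector_space_fun_scale)
  show ?thesis
  proof
    show "subspace (L_space S)" by (rule subspace_L_space)
    fix f g h :: "'a \<Rightarrow> complex" and k
    show "L_inner S f g = cnj (L_inner S g f)"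
      by (simp add: L_inner_def mult.commute)
    show "L_inner S f (g + h) = L_inner S f g + L_inner S f h"
      by (simp add: L_inner_def algebra_simps sum.distrib)
    show "L_inner S f (fun_scale k g) = k * L_inner S f g"
      by (simp add: L_inner_def fun_scale_def sum_distrib_left mult_ac)
    assume f: "f \<in> L_space S" "f \<noteq> 0"
    then obtain s where s: "s \<in> S" "f s \<noteq> 0"
      by (auto simp: L_space_def fun_eq_iff)
    show "0 < Re (L_inner S f f)"
      unfolding L_inner_self by (rule sum_pos2[OF assms s(1)]) (use s in auto)
  next
    show "Metric_space.mcomplete (L_space S)
        (\<lambda>a b. sqrt (Re (L_inner S (a - b) (a - b))))"
      unfolding L_dist_eq by (rule mcomplete_L_space[OF assms])
  qed
qed

section \<open>Valencies\<close>

context coherent_configuration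
begin

section \<open>Relations, intersection numbers and row sizes\<close>

lemma subset_points: "s \<in> S \<Longrightarrow> s \<subseteq> X \<times> X"
  using partition by (auto simp: partition_on_def)

lemma finite_relation: "s \<in> S \<Longrightarrow> finite s"
  using subset_points finite_points by (meson finite_SigmaI finite_subset)

lemma finite_relations: "finite S"
  using subset_points finite_points by (intro finite_subset[of S "Pow (X \<times> X)"]) auto

lemma relation_nonempty: "s \<in> S \<Longrightarrow> s \<noteq> {}"
  using partition by (auto simp: partition_on_def)

lemma relation_unique: "s \<in> S \<Longrightarrow> t \<in> S \<Longrightarrow> e \<in> s \<Longrightarrow> e \<in> t \<Longrightarrow> s = t"
  using partition by (auto simp: partition_on_def disjoint_def)

lemma relation_exists:
  assumes "x \<in> X" "y \<in> X"
  obtains s where "s \<in> S" "(x, y) \<in> s"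
  using partition assms by (auto simp: partition_on_def)

text \<open>The given pair \<open>(x, y)\<close> shows that \<open>c\<close> is nonempty; this makes
  the number in the definite description unique.\<close>

lemma intersection_number_eq:
  assumes "a \<in> S" "b \<in> S" "c \<in> S" "(x, y) \<in> c"
  shows "card {z \<in> X. (x, z) \<in> a \<and> (z, y) \<in> b} = intersection_number X a b c"
proof -
  obtain n where n: "\<forall>(x, y) \<in> c. card {z \<in> X. (x, z) \<in> a \<and> (z, y) \<in> b} = n"
    using regular assms by meson
  then have "intersection_number X a b c = n"
    unfolding intersection_number_def using assms(4) by (intro the_equality) auto
  with n assms(4) show ?thesis by auto
qed

text \<open>Take the relation \<open>p\<close> containing \<open>(x0, x0)\<close> for one pair
  \<open>(x0, y0)\<close> of \<open>a\<close>. Regularity for the triple \<open>p\<close>,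
  \<open>a\<close>, \<open>a\<close> forces the loop at every point of \<open>Domain a\<close> into
  \<open>p\<close>. Regularity for \<open>a\<close>, its converse and \<open>p\<close> makes the row
  size of \<open>a\<close> constant along \<open>p\<close>; it is nonzero at \<open>x0\<close>, so
  no point of \<open>p\<close> lies outside \<open>Domain a\<close>.\<close>

lemma Domain_relation:
  assumes a: "a \<in> S"
  obtains p where "p \<in> S" "p \<subseteq> Id_on X" "p = Id_on (Domain a)"
    "\<And>x y. x \<in> Domain a \<Longrightarrow> y \<in> Domain a \<Longrightarrow> card (a `` {x}) = card (a `` {y})"
proof -
  obtain x0 y0 where xy0: "(x0, y0) \<in> a"
    using relation_nonempty[OF a] by auto
  have x0: "x0 \<in> X" using xy0 subset_points[OF a] by auto
  obtain p where p: "p \<in> S" "(x0, x0) \<in> p"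
    using relation_exists[OF x0 x0] .
  have pId: "p \<subseteq> Id_on X" using diagonal p by blast
  have in_p: "(x, x) \<in> p" if "(x, y) \<in> a" for x y
  proof (rule ccontr)
    assume "(x, x) \<notin> p"
    \<comment> \<open>Since \<open>p\<close> is diagonal, the only candidate for \<open>z\<close> is
      \<open>x\<close> itself. Hence the count is 0 here, but 1 at \<open>(x0, y0)\<close>.\<close>
    then have "{z \<in> X. (x, z) \<in> p \<and> (z, y) \<in> a} = {}" using pId by auto
    then have "intersection_number X p a a = 0"
      using intersection_number_eq[OF p(1) a a that] by (metis card.empty)
    moreover have "{z \<in> X. (x0, z) \<in> p \<and> (z, y0) \<in> a} = {x0}"
      using pId p(2) xy0 x0 by auto
    then have "intersection_number X p a a = 1"
      using intersection_number_eq[OF p(1) a a xy0] by (metis card_1_singleton_iff One_nat_def)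
    ultimately show False by simp
  qed
  have val: "card (a `` {x}) = intersection_number X a (a\<inverse>) p" if "(x, x) \<in> p" for x
  proof -
    \<comment> \<open>The paths from \<open>x\<close> along \<open>a\<close> and back along its
      converse correspond to the \<open>a\<close>-neighbours of \<open>x\<close>, so an intersection
      number counts the row.\<close>
    have "a `` {x} = {z \<in> X. (x, z) \<in> a \<and> (z, x) \<in> a\<inverse>}"
      using subset_points[OF a] by auto
    then show ?thesis
      using intersection_number_eq[OF a converse_closed[OF a] p(1) that] by simp
  qed
  have fin: "finite (a `` {x})" for x
    using finite_relation[OF a] by (rule finite_Image)
  have "card (a `` {x0}) \<noteq> 0" using fin xy0 by auto
  have dom: "x \<in> Domain a" if "(x, x) \<in> p" for x
  proof -
    have "card (a `` {x}) \<noteq> 0"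
      using \<open>card (a `` {x0}) \<noteq> 0\<close> val[OF that] val[OF p(2)] by simp
    then have "a `` {x} \<noteq> {}" by (metis card.empty)
    then show ?thesis by auto
  qed
  have "p = Id_on (Domain a)"
    using in_p dom pId by (auto simp: Id_on_def)
  moreover have "card (a `` {x}) = card (a `` {y})" if "x \<in> Domain a" "y \<in> Domain a" for x y
    using val in_p that by (metis Domain.cases)
  ultimately show thesis using that p(1) pId by blast
qed

text \<open>Rows over \<open>Domain a\<close> have equal size by \<open>Domain_relation\<close>,
  which justifies the definite description in \<open>valency\<close>.\<close>

lemma valency_eq:
  assumes a: "a \<in> S" and x: "x \<in> Domain a"
  shows "card (a `` {x}) = valency a"
proof -
  have "card (a `` {y}) = card (a `` {x})" if "y \<in> Domain a" for y
    using Domain_relation[OF a] x that by metis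
  then have "valency a = card (a `` {x})"
    unfolding valency_def using x by (intro the_equality) metis+
  then show ?thesis by simp
qed

lemma valency_pos:
  assumes a: "a \<in> S"
  shows "valency a > 0"
proof -
  obtain x y where xy: "(x, y) \<in> a" using relation_nonempty[OF a] by auto
  have "finite (a `` {x})" using finite_relation[OF a] by (rule finite_Image)
  then have "card (a `` {x}) > 0" using xy by (auto simp: card_gt_0_iff)
  then show ?thesis using valency_eq[OF a DomainI[OF xy]] by simp
qed

lemma valency_diagonal:
  assumes p: "p \<in> S" "p \<subseteq> Id_on X"
  shows "valency p = 1"
proof -
  obtain x y where xy: "(x, y) \<in> p" using relation_nonempty[OF p(1)] by auto
  then have "p `` {x} = {x}" using p by auto
  then show ?thesis using valency_eq[OF p(1) DomainI[OF xy]] by simp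
qed

section \<open>Sizes of relations under half-homogeneity\<close>

lemma card_relation:
  assumes a: "a \<in> S"
  shows "card a = card (Domain a) * valency a"
proof -
  have "a = Sigma (Domain a) (\<lambda>x. a `` {x})" by auto
  then have "card a = card (Sigma (Domain a) (\<lambda>x. a `` {x}))" by simp
  also have "\<dots> = (\<Sum>x\<in>Domain a. card (a `` {x}))"
    using finite_relation[OF a] by (intro card_SigmaI finite_Domain) (auto intro: finite_Image)
  also have "\<dots> = (\<Sum>x\<in>Domain a. valency a)"
    using valency_eq[OF a] by (intro sum.cong) auto
  finally show ?thesis by simp
qed

text \<open>The factor \<open>m\<close> is the size of \<open>Domain s\<close>. It does not depend
  on \<open>s\<close>, because \<open>Id_on (Domain s)\<close> is a diagonal relation in
  \<open>S\<close> and all of these have equal size.\<close>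

lemma half_homogeneous_card:
  assumes "half_homogeneous X S"
  obtains m where "m > 0" "\<And>s. s \<in> S \<Longrightarrow> card s = m * valency s"
proof (cases "S = {}")
  case True
  \<comment> \<open>The equation is vacuous here, so any positive \<open>m\<close> would do.\<close>
  then show ?thesis using that[of 1] by auto
next
  case False
  then obtain t where t: "t \<in> S" by auto
  have "card (Domain s) = card (Domain t)" if s: "s \<in> S" for s
  proof -
    have "card (Id_on A) = card A" for A :: "'a set"
    proof -
      have "Id_on A = (\<lambda>x. (x, x)) ` A" by auto
      then show ?thesis by (simp add: card_image inj_on_def)
    qed
    then show ?thesis
      using Domain_relation[OF s] Domain_relation[OF t] assms
      unfolding half_homogeneous_def by metis
  qed
  moreover have "card (Domain t) > 0"
    using relation_nonempty[OF t] finite_relation[OF t]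
    by (auto simp: card_gt_0_iff finite_Domain)
  ultimately show ?thesis using that card_relation by metis
qed

text \<open>A relation and its converse have equally many pairs; cancelling the common factor
  \<open>m\<close> gives equal valencies.\<close>

lemma valency_converse:
  assumes "half_homogeneous X S" "s \<in> S"
  shows "valency (s\<inverse>) = valency s"
proof -
  obtain m where "m > 0" "\<And>s. s \<in> S \<Longrightarrow> card s = m * valency s"
    using half_homogeneous_card assms(1) by blast
  then show ?thesis
    using assms(2) converse_closed by (metis card_inverse mult_left_cancel not_gr_zero)
qed

section \<open>The matrix representation\<close>

text \<open>At a point of \<open>X\<close> \<times> \<open>X\<close> exactly one summand has a true
  condition. Writing the entry as a sum over \<open>S\<close>, instead of choosing that relation,
  lets products of matrices be expanded by distributivity.\<close>

definition adj_matrix :: "('a rel \<Rightarrow> complex) \<Rightarrow> 'a \<Rightarrow> 'a \<Rightarrow> complex" where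
  "adj_matrix f x y = (\<Sum>s\<in>S. if (x, y) \<in> s then f s / sqrt (valency s) else 0)"

lemma adj_matrix_eq:
  assumes "s \<in> S" "(x, y) \<in> s"
  shows "adj_matrix f x y = f s / sqrt (valency s)"
proof -
  have "adj_matrix f x y = (\<Sum>t\<in>S. if t = s then f s / sqrt (valency s) else 0)"
    unfolding adj_matrix_def using relation_unique assms by (intro sum.cong) auto
  then show ?thesis using assms finite_relations by simp
qed

text \<open>Each \<open>s\<close> in \<open>S\<close> contains a pair, and the entry there is
  \<open>f s\<close> divided by a positive number, so the matrix determines \<open>f\<close>. This
  reduces identities in the algebra to matrix identities.\<close>

lemma adj_matrix_inject:
  assumes "f \<in> L_space S" "g \<in> L_space S"
    and eq: "\<And>x y. x \<in> X \<Longrightarrow> y \<in> X \<Longrightarrow> adj_matrix f x y = adj_matrix g x y"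
  shows "f = g"
proof (rule L_space_eqI[OF assms(1,2)])
  fix s assume s: "s \<in> S"
  then obtain x y where xy: "(x, y) \<in> s" using relation_nonempty by fastforce
  then show "f s = g s"
    using eq[of x y] subset_points[OF s] valency_pos[OF s] adj_matrix_eq[OF s xy] by auto
qed

section \<open>Multiplication and unit as matrix operations\<close>

lemma L_mult_apply:
  "L_mult X S f g c =
    (if c \<in> S then \<Sum>a\<in>S. \<Sum>b\<in>S. f a * g b * normalized_number X a b c else 0)"
proof -
  have "L_mult X S f g c = (\<Sum>a\<in>S. \<Sum>b\<in>S. f a * g b *
      (\<Sum>c\<in>S. fun_scale (complex_of_real (normalized_number X a b c)) (ket c)) c)"
    unfolding L_mult_def sum_fun_apply[of _ S] by (simp add: fun_scale_def)
  then show ?thesis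
    by (simp add: sum_scale_ket_apply finite_relations)
qed

lemma L_mult_closed: "L_mult X S f g \<in> L_space S"
  by (simp add: L_space_def L_mult_apply)

lemma adj_matrix_mult:
  assumes x: "x \<in> X" and y: "y \<in> X"
  shows "adj_matrix (L_mult X S f g) x y = (\<Sum>z\<in>X. adj_matrix f x z * adj_matrix g z y)"
proof -
  obtain c where c: "c \<in> S" "(x, y) \<in> c" using relation_exists[OF x y] .
  let ?k = "\<lambda>a b. f a / sqrt (valency a) * (g b / sqrt (valency b))"
  have "(\<Sum>z\<in>X. adj_matrix f x z * adj_matrix g z y)
      = (\<Sum>z\<in>X. \<Sum>a\<in>S. \<Sum>b\<in>S. if (x, z) \<in> a \<and> (z, y) \<in> b then ?k a b else 0)"
    unfolding adj_matrix_def sum_product by (intro sum.cong) auto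
  also have "\<dots> = (\<Sum>a\<in>S. \<Sum>b\<in>S. \<Sum>z\<in>X. if (x, z) \<in> a \<and> (z, y) \<in> b then ?k a b else 0)"
    by (subst sum.swap, intro sum.cong refl sum.swap)
  \<comment> \<open>For fixed \<open>a\<close> and \<open>b\<close> the summand is constant in
    \<open>z\<close>, so the inner sum counts the intermediate points between \<open>x\<close> and
    \<open>y\<close>; \<open>(x, y)\<close> lies in \<open>c\<close>.\<close>
  also have "\<dots> = (\<Sum>a\<in>S. \<Sum>b\<in>S. of_nat (intersection_number X a b c) * ?k a b)"
    using finite_points c
    by (intro sum.cong refl) (simp add: intersection_number_eq flip: sum.inter_filter)
  \<comment> \<open>The square root in \<open>normalized_number\<close> is exactly what the scaling
    of the matrices demands: its numerator cancels against the factor for \<open>c\<close>.\<close>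
  also have "\<dots> = (\<Sum>a\<in>S. \<Sum>b\<in>S. f a * g b * normalized_number X a b c / sqrt (valency c))"
    using valency_pos[OF c(1)]
    by (intro sum.cong refl) (simp add: normalized_number_def real_sqrt_mult real_sqrt_divide)
  also have "\<dots> = adj_matrix (L_mult X S f g) x y"
    using c by (simp add: adj_matrix_eq L_mult_apply sum_divide_distrib)
  finally show ?thesis by simp
qed

lemma L_unit_apply: "L_unit X S s = (if s \<in> S \<and> s \<subseteq> Id_on X then 1 else 0)"
proof -
  have "L_unit X S s = (\<Sum>p \<in> {p \<in> S. p \<subseteq> Id_on X}. if s = p then 1 else 0)"
    by (simp only: L_unit_def sum_fun_apply ket_def)
  then show ?thesis using finite_relations by simp
qed

lemma L_unit_closed: "L_unit X S \<in> L_space S"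
  by (simp add: L_space_def L_unit_apply)

text \<open>Diagonal relations have valency 1, so the scaling leaves their entries equal to
  1.\<close>

lemma adj_matrix_unit:
  assumes x: "x \<in> X" and y: "y \<in> X"
  shows "adj_matrix (L_unit X S) x y = (if x = y then 1 else 0)"
proof -
  obtain s where s: "s \<in> S" "(x, y) \<in> s" using relation_exists[OF x y] .
  have "s \<subseteq> Id_on X \<longleftrightarrow> x = y" using s diagonal by auto
  then show ?thesis
    using s valency_diagonal[OF s(1)] by (simp add: adj_matrix_eq L_unit_apply)
qed

text \<open>Bilinearity is checked on coefficients. Associativity and the unit laws are pulled back
  from matrices along the injective map \<open>adj_matrix\<close>.\<close>

lemma complex_algebra_L_space:
  "complex_algebra fun_scale (L_space S) (L_mult X S) (L_unit X S)"
proof -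
  interpret vector_space "fun_scale :: complex \<Rightarrow> ('a rel \<Rightarrow> complex) \<Rightarrow> _"
    by (rule vector_space_fun_scale)
  show ?thesis
  proof
    show "subspace (L_space S)" by (rule subspace_L_space)
    show "L_unit X S \<in> L_space S" by (rule L_unit_closed)
    fix f g h :: "'a rel \<Rightarrow> complex" and k
    show "L_mult X S f g \<in> L_space S" by (rule L_mult_closed)
    show "L_mult X S (f + g) h = L_mult X S f h + L_mult X S g h"
      by (auto simp: fun_eq_iff L_mult_apply algebra_simps sum.distrib)
    show "L_mult X S f (g + h) = L_mult X S f g + L_mult X S f h"
      by (auto simp: fun_eq_iff L_mult_apply algebra_simps sum.distrib)
    show "L_mult X S (fun_scale k f) g = fun_scale k (L_mult X S f g)"
      by (auto simp: fun_eq_iff L_mult_apply fun_scale_def sum_distrib_left mult_ac)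
    show "L_mult X S f (fun_scale k g) = fun_scale k (L_mult X S f g)"
      by (auto simp: fun_eq_iff L_mult_apply fun_scale_def sum_distrib_left mult_ac)
    show "L_mult X S (L_mult X S f g) h = L_mult X S f (L_mult X S g h)"
    proof (rule adj_matrix_inject[OF L_mult_closed L_mult_closed])
      fix x y assume x: "x \<in> X" and y: "y \<in> X"
      have "adj_matrix (L_mult X S (L_mult X S f g) h) x y
          = (\<Sum>z\<in>X. \<Sum>w\<in>X. adj_matrix f x w * adj_matrix g w z * adj_matrix h z y)"
        using x y by (simp add: adj_matrix_mult sum_distrib_right)
      also have "\<dots> = (\<Sum>w\<in>X. \<Sum>z\<in>X. adj_matrix f x w * adj_matrix g w z * adj_matrix h z y)"
        by (rule sum.swap)
      also have "\<dots> = adj_matrix (L_mult X S f (L_mult X S g h)) x y"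
        using x y by (simp add: adj_matrix_mult sum_distrib_left mult.assoc)
      finally show "adj_matrix (L_mult X S (L_mult X S f g) h) x y
          = adj_matrix (L_mult X S f (L_mult X S g h)) x y" .
    qed
    assume f: "f \<in> L_space S"
    show "L_mult X S (L_unit X S) f = f"
    proof (rule adj_matrix_inject[OF L_mult_closed f])
      fix x y assume "x \<in> X" "y \<in> X"
      then show "adj_matrix (L_mult X S (L_unit X S) f) x y = adj_matrix f x y"
        using finite_points
        by (simp add: adj_matrix_mult adj_matrix_unit if_distrib[of "\<lambda>u. u * _"] cong: if_cong)
    qed
    show "L_mult X S f (L_unit X S) = f"
    proof (rule adj_matrix_inject[OF L_mult_closed f])
      fix x y assume "x \<in> X" "y \<in> X"
      then show "adj_matrix (L_mult X S f (L_unit X S)) x y = adj_matrix f x y"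
        using finite_points
        by (simp add: adj_matrix_mult adj_matrix_unit if_distrib[of "\<lambda>u. _ * u"] cong: if_cong)
    qed
  qed
qed

section \<open>The Frobenius inner product and the involution\<close>

lemma L_inner_adj_matrix:
  assumes m: "\<And>s. s \<in> S \<Longrightarrow> card s = m * valency s"
  shows "of_nat m * L_inner S f g
    = (\<Sum>x\<in>X. \<Sum>y\<in>X. cnj (adj_matrix f x y) * adj_matrix g x y)"
proof -
  let ?h = "\<lambda>(x, y). cnj (adj_matrix f x y) * adj_matrix g x y"
  have "(\<Sum>x\<in>X. \<Sum>y\<in>X. cnj (adj_matrix f x y) * adj_matrix g x y) = sum ?h (\<Union>S)"
    using partition by (simp add: sum.cartesian_product partition_on_def)
  also have "\<dots> = (\<Sum>s\<in>S. sum ?h s)"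
    using finite_relation partition
    by (subst sum.Union_disjoint) (auto simp: partition_on_def disjoint_def)
  \<comment> \<open>All pairs in \<open>s\<close> contribute the same term, with denominator
    \<open>valency s\<close>, and there are \<open>m * valency s\<close> of them.\<close>
  also have "\<dots> = (\<Sum>s\<in>S. of_nat m * (cnj (f s) * g s))"
  proof (rule sum.cong[OF refl])
    fix s assume s: "s \<in> S"
    have "sum ?h s = (\<Sum>e\<in>s. cnj (f s) * g s / of_nat (valency s))"
    proof (rule sum.cong[OF refl], clarify)
      fix x y assume "(x, y) \<in> s"
      then have "cnj (adj_matrix f x y) * adj_matrix g x y
          = cnj (f s) * g s / complex_of_real (sqrt (valency s) * sqrt (valency s))"
        unfolding of_real_mult using s by (simp add: adj_matrix_eq)
      then show "cnj (adj_matrix f x y) * adj_matrix g x y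
          = cnj (f s) * g s / of_nat (valency s)" by simp
    qed
    then show "sum ?h s = of_nat m * (cnj (f s) * g s)"
      using m[OF s] valency_pos[OF s] by simp
  qed
  finally show ?thesis by (simp add: L_inner_def sum_distrib_left)
qed

lemma hstar_involution_L_space:
  assumes "half_homogeneous X S"
  shows "hstar_involution fun_scale (L_space S) (L_mult X S) (L_inner S)
    (\<lambda>f s. cnj (f (s\<inverse>)))"
proof -
  let ?dag = "\<lambda>f (s :: 'a rel). cnj (f (s\<inverse>))"
  obtain m where m0: "m > 0" and m: "\<And>s. s \<in> S \<Longrightarrow> card s = m * valency s"
    using half_homogeneous_card assms by blast
  note inner = L_inner_adj_matrix[OF m]
  have conv: "s\<inverse> \<in> S \<longleftrightarrow> s \<in> S" for s
    using converse_closed by (metis converse_converse)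
  \<comment> \<open>The involution is the conjugate transpose; the scaling factors agree because
    \<open>s\<close> and its converse have the same valency.\<close>
  have dag: "adj_matrix (?dag f) x y = cnj (adj_matrix f y x)"
    if x: "x \<in> X" and y: "y \<in> X" for f x y
  proof -
    obtain s where s: "s \<in> S" "(x, y) \<in> s" using relation_exists[OF x y] .
    then show ?thesis
      using adj_matrix_eq[of "s\<inverse>" y x] conv
      by (simp add: adj_matrix_eq valency_converse[OF assms])
  qed
  have left: "L_inner S (L_mult X S f g) h = L_inner S g (L_mult X S (?dag f) h)" for f g h
  proof -
    \<comment> \<open>Both sides are the triple sum of \<open>?t\<close>. On the right-hand side
      \<open>z\<close> and \<open>y\<close> index the entries and \<open>x\<close> is the summation
      index of the inner matrix product, so the order of summation is reversed.\<close>
    let ?t = "\<lambda>x y z. cnj (adj_matrix f x z) * cnj (adj_matrix g z y) * adj_matrix h x y"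
    have "of_nat m * L_inner S (L_mult X S f g) h = (\<Sum>x\<in>X. \<Sum>y\<in>X. \<Sum>z\<in>X. ?t x y z)"
      by (simp add: inner adj_matrix_mult sum_distrib_right)
    also have "\<dots> = (\<Sum>z\<in>X. \<Sum>y\<in>X. \<Sum>x\<in>X. ?t x y z)"
      by (subst sum.swap, subst (2) sum.swap, subst sum.swap) (rule refl)
    also have "\<dots> = of_nat m * L_inner S g (L_mult X S (?dag f) h)"
      by (simp add: inner adj_matrix_mult dag sum_distrib_left mult_ac)
    finally show ?thesis using m0 by simp
  qed
  have right: "L_inner S (L_mult X S f g) h = L_inner S f (L_mult X S h (?dag g))" for f g h
  proof -
    \<comment> \<open>Now \<open>x\<close> and \<open>z\<close> index the entries on the right-hand
      side and \<open>y\<close> is the inner index, so only the two inner sums trade places.\<close>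
    let ?t = "\<lambda>x y z. cnj (adj_matrix f x z) * cnj (adj_matrix g z y) * adj_matrix h x y"
    have "of_nat m * L_inner S (L_mult X S f g) h = (\<Sum>x\<in>X. \<Sum>y\<in>X. \<Sum>z\<in>X. ?t x y z)"
      by (simp add: inner adj_matrix_mult sum_distrib_right)
    also have "\<dots> = (\<Sum>x\<in>X. \<Sum>z\<in>X. \<Sum>y\<in>X. ?t x y z)"
      by (intro sum.cong refl sum.swap)
    also have "\<dots> = of_nat m * L_inner S f (L_mult X S h (?dag g))"
      by (simp add: inner adj_matrix_mult dag sum_distrib_left mult_ac)
    finally show ?thesis using m0 by simp
  qed
  show ?thesis
    unfolding hstar_involution_def
    using left right by (auto simp: L_space_def conv fun_scale_def fun_eq_iff)
qed

end

theorem theorem6p6: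
  fixes X :: "'a set" and S :: "'a rel set"
  assumes "coherent_configuration X S"
    and "half_homogeneous X S"
  shows "finite_dimensional fun_scale (L_space S) \<and>
    hstar_algebra fun_scale (L_space S) (L_mult X S) (L_unit X S) (L_inner S)"
proof -
  interpret coherent_configuration X S by fact
  show ?thesis
    using finite_dimensional_L_space[OF finite_relations] complex_algebra_L_space
      complex_hilbert_space_L_space[OF finite_relations] hstar_involution_L_space[OF assms(2)]
    unfolding hstar_algebra_def by blast
qed

end
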